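(* Let $G$ be a countably infinite amenable group and $G\curvearrowright X$ a minimal expansive action on a compact metrizable space by homeomorphisms with the strong topological Markov property. Then $h_{\rm top}(G\curvearrowright X)=0$.
   Context: Fix a compatible metric $d$ on $X$ (the notions below do not depend on its choice). For $K\subset G$ and $x,y\in X$ write $d_K(x,y)=\sup_{g\in K}d(gx,gy)$. Minimal: every closed $G$-invariant subset of $X$ is either $X$ or empty. Expansive: there is $c>0$ such that for all $x\neq y$ in $X$ there is $g\in G$ with $d(gx,gy)>c$. Memory set: for $\varepsilon,\delta>0$ and finite $A\subset B\subset G$, $B$ is an $(\varepsilon,\delta)$-memory set for $A$ if for every $x,y\in X$ with $d_{B\setminus A}(x,y)\le\delta$ there is $z\in X$ with $d_B(x,z)\le\varepsilon$ and $d_{G\setminus A}(y,z)\le\varepsilon$. Strong topological Markov property: for every $\varepsilon>0$ there exist $\delta>0$ and a finite set $F\subset G$ containing the identity such that for every finite $A\subset G$ the set $FA$ is an $(\varepsilon,\delta)$-memory set for $A$. Topological entropy: for an open cover $\mathcal U$ and nonempty finite $F\subset G$, $N(\mathcal U^F)$ is the minimal cardinality of a subcover of $\mathcal U^F=\bigvee_{g\in F}g^{-1}\mathcal U$; $h_{\rm top}(G\curvearrowright X)=\sup_{\mathcal U}\lim_n\frac1{|F_n|}\log N(\mathcal U^{F_n})$, where $\{F_n\}$ is any left F\o lner sequence ($|KF_n\,\Delta\,F_n|/|F_n|\to0$ for every finite nonempty $K\subset G$). *)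

theory Defs
  imports "HOL-Analysis.Analysis" "HOL-Algebra.Coset" "HOL-Algebra.Group_Action"
begin

definition left_Folner_sequence :: "('g, 'm) monoid_scheme \<Rightarrow> (nat \<Rightarrow> 'g set) \<Rightarrow> bool" where
  "left_Folner_sequence G F \<longleftrightarrow>
     (\<forall>n. finite (F n) \<and> F n \<noteq> {} \<and> F n \<subseteq> carrier G) \<and>
     (\<forall>K. finite K \<and> K \<noteq> {} \<and> K \<subseteq> carrier G \<longrightarrow>
        (\<lambda>n. real (card (sym_diff (K <#>\<^bsub>G\<^esub> F n) (F n))) / real (card (F n))) \<longlonglongrightarrow> 0)"

definition amenable :: "('g, 'm) monoid_scheme \<Rightarrow> bool" where
  "amenable G \<longleftrightarrow> (\<exists>F. left_Folner_sequence G F)"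

definition action_by_homeos ::
    "('g, 'm) monoid_scheme \<Rightarrow> 'x topology \<Rightarrow> ('g \<Rightarrow> 'x \<Rightarrow> 'x) \<Rightarrow> bool" where
  "action_by_homeos G X \<phi> \<longleftrightarrow>
     group_action G (topspace X) \<phi> \<and> (\<forall>g\<in>carrier G. homeomorphic_map X X (\<phi> g))"

definition minimal_action ::
    "('g, 'm) monoid_scheme \<Rightarrow> 'x topology \<Rightarrow> ('g \<Rightarrow> 'x \<Rightarrow> 'x) \<Rightarrow> bool" where
  "minimal_action G X \<phi> \<longleftrightarrow>
     (\<forall>C. closedin X C \<and> (\<forall>g\<in>carrier G. \<phi> g ` C \<subseteq> C) \<longrightarrow> C = topspace X \<or> C = {})"

definition expansive_action ::
    "('g, 'm) monoid_scheme \<Rightarrow> 'x topology \<Rightarrow> ('x \<Rightarrow> 'x \<Rightarrow> real) \<Rightarrow> ('g \<Rightarrow> 'x \<Rightarrow> 'x) \<Rightarrow> bool" where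
  "expansive_action G X d \<phi> \<longleftrightarrow>
     (\<exists>c>0. \<forall>x\<in>topspace X. \<forall>y\<in>topspace X. x \<noteq> y \<longrightarrow> (\<exists>g\<in>carrier G. d (\<phi> g x) (\<phi> g y) > c))"

text \<open>The supremum is taken in the extended nonnegative reals, so that it is 0 for empty \<open>K\<close>.\<close>

definition dist_along ::
    "('x \<Rightarrow> 'x \<Rightarrow> real) \<Rightarrow> ('g \<Rightarrow> 'x \<Rightarrow> 'x) \<Rightarrow> 'g set \<Rightarrow> 'x \<Rightarrow> 'x \<Rightarrow> ennreal" where
  "dist_along d \<phi> K x y = (SUP g\<in>K. ennreal (d (\<phi> g x) (\<phi> g y)))"

definition memory_set ::
    "('g, 'm) monoid_scheme \<Rightarrow> 'x topology \<Rightarrow> ('x \<Rightarrow> 'x \<Rightarrow> real) \<Rightarrow> ('g \<Rightarrow> 'x \<Rightarrow> 'x) \<Rightarrow>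
     real \<Rightarrow> real \<Rightarrow> 'g set \<Rightarrow> 'g set \<Rightarrow> bool" where
  "memory_set G X d \<phi> \<epsilon> \<delta> B A \<longleftrightarrow>
     (\<forall>x\<in>topspace X. \<forall>y\<in>topspace X. dist_along d \<phi> (B - A) x y \<le> ennreal \<delta> \<longrightarrow>
        (\<exists>z\<in>topspace X. dist_along d \<phi> B x z \<le> ennreal \<epsilon> \<and>
                        dist_along d \<phi> (carrier G - A) y z \<le> ennreal \<epsilon>))"

definition strong_topological_Markov_property ::
    "('g, 'm) monoid_scheme \<Rightarrow> 'x topology \<Rightarrow> ('x \<Rightarrow> 'x \<Rightarrow> real) \<Rightarrow> ('g \<Rightarrow> 'x \<Rightarrow> 'x) \<Rightarrow> bool" where
  "strong_topological_Markov_property G X d \<phi> \<longleftrightarrow>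
     (\<forall>\<epsilon>>0. \<exists>\<delta>>0. \<exists>F. finite F \<and> F \<subseteq> carrier G \<and> \<one>\<^bsub>G\<^esub> \<in> F \<and>
        (\<forall>A. finite A \<and> A \<subseteq> carrier G \<longrightarrow> memory_set G X d \<phi> \<epsilon> \<delta> (F <#>\<^bsub>G\<^esub> A) A))"

definition open_cover :: "'x topology \<Rightarrow> 'x set set \<Rightarrow> bool" where
  "open_cover X \<U> \<longleftrightarrow> (\<forall>V\<in>\<U>. openin X V) \<and> \<Union>\<U> = topspace X"

text \<open>The join over \<open>g \<in> F\<close> of the pulled-back covers \<open>g\<^sup>-\<^sup>1\<U>\<close>: its members arise by choosing
  some \<open>V g \<in> \<U>\<close> for every \<open>g \<in> F\<close> and intersecting the preimages of the \<open>V g\<close> under \<open>g\<close>.\<close>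

definition join_cover ::
    "'x topology \<Rightarrow> ('g \<Rightarrow> 'x \<Rightarrow> 'x) \<Rightarrow> 'x set set \<Rightarrow> 'g set \<Rightarrow> 'x set set" where
  "join_cover X \<phi> \<U> F = {{x \<in> topspace X. \<forall>g\<in>F. \<phi> g x \<in> V g} | V. \<forall>g\<in>F. V g \<in> \<U>}"

definition min_subcover_card :: "'x topology \<Rightarrow> 'x set set \<Rightarrow> nat" where
  "min_subcover_card X \<C> =
     (LEAST n. \<exists>\<W>\<subseteq>\<C>. finite \<W> \<and> card \<W> = n \<and> \<Union>\<W> = topspace X)"

text \<open>Topological entropy computed along the left Folner sequence \<open>F\<close>. By the Ornstein--Weiss lemma
  the limits exist and do not depend on \<open>F\<close>.\<close>

definition topological_entropy ::
    "'x topology \<Rightarrow> ('g \<Rightarrow> 'x \<Rightarrow> 'x) \<Rightarrow> (nat \<Rightarrow> 'g set) \<Rightarrow> ereal" where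
  "topological_entropy X \<phi> F =
     (SUP \<U>\<in>{\<U>. open_cover X \<U>}.
        lim (\<lambda>n. ereal (ln (real (min_subcover_card X (join_cover X \<phi> \<U> (F n)))) / real (card (F n)))))"

end

theory Submission
  imports Defs "HOL-Real_Asymp.Real_Asymp"
begin

text \<open>The heart of the proof is a rigidity statement: for every \<open>r > 0\<close> there are \<open>\<delta> > 0\<close> and a finite \<open>F\<close>
  such that two points whose orbits are \<open>\<delta>\<close>-close along \<open>FA - A\<close> are \<open>r\<close>-close along \<open>A\<close>, for every
  finite \<open>A\<close>. If it failed for \<open>p\<close>, \<open>q\<close> and \<open>A\<close>, one could replace \<open>p\<close> by \<open>q\<close> at will in a relatively
  dense family of places of an orbit, and a counting argument would produce orbits that avoid a
  neighbourhood of \<open>p\<close>, against minimality. Rigidity means that the number of orbit pieces along a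
  Folner set \<open>F n\<close> is at most exponential in the size of its boundary, so the entropy is 0.\<close>

section \<open>Counting and disjoint translates\<close>

text \<open>Supplies the block size \<open>k\<close> for rigidity: the \<open>2 ^ k\<close>
  replacement patterns of a block outnumber the positions that can see it.\<close>

lemma quadratic_less_exponential: "\<exists>k>0. (m * k)\<^sup>2 < (2::nat) ^ k"
proof -
  have "\<forall>\<^sub>F k in sequentially. (real k)\<^sup>2 * c < 2 ^ k" if "c > 0" for c :: real
    using that by real_asymp
  \<comment> \<open>Adding 1 keeps the constant positive when \<open>m = 0\<close>.\<close>
  then have "\<forall>\<^sub>F k in sequentially. (real k)\<^sup>2 * ((real m)\<^sup>2 + 1) < 2 ^ k"
    by (simp add: add_nonneg_pos)
  then have "\<forall>\<^sub>F k in sequentially. 0 < k \<and> (real k)\<^sup>2 * ((real m)\<^sup>2 + 1) < 2 ^ k"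
    by (intro eventually_conj eventually_gt_at_top)
  then obtain k where k: "0 < k" "(real k)\<^sup>2 * ((real m)\<^sup>2 + 1) < 2 ^ k"
    by (auto simp: eventually_at_top_linorder)
  have "(real m * real k)\<^sup>2 \<le> (real k)\<^sup>2 * ((real m)\<^sup>2 + 1)"
    by (simp add: power_mult_distrib algebra_simps)
  then have "real ((m * k)\<^sup>2) < real (2 ^ k)" using k(2) by simp
  then show ?thesis using k(1) of_nat_less_iff by blast
qed

text \<open>Pigeonhole on \<open>Pow H\<close>; used to pick a replacement pattern that differs from
  every forbidden one.\<close>

lemma avoid_finite_family:
  assumes "finite H" "card \<Q> < 2 ^ card H" "finite \<Q>"
  shows "\<exists>w. w \<subseteq> H \<and> w \<notin> \<Q>"
proof (rule ccontr)
  assume "\<not> ?thesis"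
  then have "Pow H \<subseteq> \<Q>" by auto
  then have "card (Pow H) \<le> card \<Q>" using assms by (simp add: card_mono)
  then show False using assms by (simp add: card_Pow)
qed

text \<open>Greedy choice: \<open>Q #> h0\<close> meets \<open>Q #> h\<close> only if
  \<open>h0\<close> is one of the finitely many \<open>inv a \<otimes> b \<otimes> h\<close> with
  \<open>a\<close>, \<open>b\<close> in \<open>Q\<close>, and an infinite group has elements outside
  a finite set.\<close>

lemma (in group) infinite_disjoint_translates:
  assumes "infinite (carrier G)" "finite Q" "Q \<subseteq> carrier G"
  shows "\<exists>H. finite H \<and> H \<subseteq> carrier G \<and> card H = k \<and> disjoint_family_on (\<lambda>h. Q #> h) H"
proof (induction k)
  case 0
  show ?case by (intro exI[of _ "{}"]) (auto simp: disjoint_family_on_def)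
next
  case (Suc k)
  then obtain H where H: "finite H" "H \<subseteq> carrier G" "card H = k"
    "disjoint_family_on (\<lambda>h. Q #> h) H" by blast
  \<comment> \<open>The part \<open>H\<close> keeps \<open>h0\<close> new even when \<open>Q\<close>
    is empty.\<close>
  define Z where "Z = H \<union> (\<lambda>((a, b), h). inv a \<otimes> b \<otimes> h) ` ((Q \<times> Q) \<times> H)"
  have "finite Z" using H assms by (auto simp: Z_def)
  then obtain h0 where h0: "h0 \<in> carrier G" "h0 \<notin> Z"
    using assms(1) by (meson finite_subset subsetI)
  have apart: "a \<otimes> h0 \<noteq> b \<otimes> h" if "a \<in> Q" "b \<in> Q" "h \<in> H" for a b h
  proof
    assume eq: "a \<otimes> h0 = b \<otimes> h"
    have c: "a \<in> carrier G" "b \<in> carrier G" "h \<in> carrier G" using that assms H by auto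
    then have "h0 = inv a \<otimes> b \<otimes> h"
      using eq h0(1) by (metis inv_closed inv_solve_left m_assoc m_closed)
    then have "h0 \<in> Z" using that by (force simp: Z_def)
    then show False using h0 by simp
  qed
  have apart': "(Q #> h0) \<inter> (Q #> h) = {}" if "h \<in> H" for h
    using apart that by (auto simp: r_coset_def)
  have "disjoint_family_on (\<lambda>h. Q #> h) (insert h0 H)"
    using H(4) apart' h0 by (auto simp: disjoint_family_on_def)
  moreover have "card (insert h0 H) = Suc k"
    using H h0 by (auto simp: Z_def)
  ultimately show ?case
    using H h0 by (intro exI[of _ "insert h0 H"]) auto
qed

text \<open>A maximal disjoint subfamily works: an index whose translate missed all chosen ones
  could be added. This thins out return times to block positions while every return time stays near
  a block.\<close>

lemma finite_disjoint_translates_net: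
  fixes G (structure)
  assumes "finite J" "J \<subseteq> carrier G" "E \<noteq> {}"
  obtains \<Sigma> where "\<Sigma> \<subseteq> J" "disjoint_family_on (\<lambda>s. E #> s) \<Sigma>"
    "\<And>g. g \<in> J \<Longrightarrow> \<exists>s\<in>\<Sigma>. (E #> g) \<inter> (E #> s) \<noteq> {}"
proof -
  define \<A> where "\<A> = {S \<in> Pow J. disjoint_family_on (\<lambda>s. E #> s) S}"
  have "finite \<A>" "{} \<in> \<A>" using assms by (auto simp: \<A>_def disjoint_family_on_def)
  then obtain \<Sigma> where \<Sigma>: "\<Sigma> \<in> \<A>" "\<And>S. S \<in> \<A> \<Longrightarrow> \<Sigma> \<subseteq> S \<Longrightarrow> \<Sigma> = S"
    using finite_has_maximal[of \<A>] by blast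
  have "\<exists>s\<in>\<Sigma>. (E #> g) \<inter> (E #> s) \<noteq> {}" if g: "g \<in> J" for g
  proof (rule ccontr)
    assume *: "\<not> ?thesis"
    then have "insert g \<Sigma> \<in> \<A>"
      using \<Sigma>(1) g by (auto simp: \<A>_def disjoint_family_on_def)
    then have "g \<in> \<Sigma>" using \<Sigma>(2) by blast
    moreover have "E #> g \<noteq> {}" using assms(3) by (auto simp: r_coset_def)
    ultimately show False using * by auto
  qed
  then show thesis using that[of \<Sigma>] \<Sigma>(1) by (auto simp: \<A>_def)
qed

section \<open>Set products and neighbourhoods of replacement regions\<close>

lemma set_multI:
  fixes G (structure)
  shows "a \<in> A \<Longrightarrow> b \<in> B \<Longrightarrow> a \<otimes> b \<in> A <#> B"
  by (auto simp: set_mult_def)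

lemma (in monoid) subset_set_mult:
  assumes "\<one> \<in> F" "B \<subseteq> carrier G"
  shows "B \<subseteq> F <#> B"
proof
  fix b assume "b \<in> B"
  then have "b = \<one> \<otimes> b" using assms by auto
  then show "b \<in> F <#> B" using set_multI assms(1) \<open>b \<in> B\<close> by metis
qed

text \<open>The places where a replacement along \<open>B\<close> matters: either the window
  \<open>K g\<close> sees \<open>B\<close>, or \<open>g\<close> lies in the set
  \<open>F <#> B\<close> on which the memory property acts. Disjointness of these sets makes
  replacements independent.\<close>

definition (in group) nbhd :: "'a set \<Rightarrow> 'a set \<Rightarrow> 'a set \<Rightarrow> 'a set" where
  "nbhd K F B = {g \<in> carrier G. \<exists>k\<in>K. k \<otimes> g \<in> B} \<union> (F <#> B)"

lemma (in group) nbhd_subset_carrier: "F \<subseteq> carrier G \<Longrightarrow> B \<subseteq> carrier G \<Longrightarrow> nbhd K F B \<subseteq> carrier G"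
  by (auto simp: nbhd_def dest: set_mult_closed)

lemma (in group) finite_nbhd:
  assumes "finite K" "K \<subseteq> carrier G" "finite F" "finite B" "B \<subseteq> carrier G"
  shows "finite (nbhd K F B)"
proof -
  have "{g \<in> carrier G. \<exists>k\<in>K. k \<otimes> g \<in> B} \<subseteq> (\<lambda>(k, b). inv k \<otimes> b) ` (K \<times> B)"
  proof
    fix g assume "g \<in> {g \<in> carrier G. \<exists>k\<in>K. k \<otimes> g \<in> B}"
    then obtain k where k: "g \<in> carrier G" "k \<in> K" "k \<otimes> g \<in> B" by auto
    then have "g = inv k \<otimes> (k \<otimes> g)" using assms by (metis inv_solve_left' m_closed subsetD)
    then show "g \<in> (\<lambda>(k, b). inv k \<otimes> b) ` (K \<times> B)" using k by force
  qed
  then have "finite {g \<in> carrier G. \<exists>k\<in>K. k \<otimes> g \<in> B}"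
    using assms by (meson finite_SigmaI finite_imageI finite_subset)
  moreover have "finite (F <#> B)" using assms by (auto simp: set_mult_def)
  ultimately show ?thesis by (simp add: nbhd_def)
qed

text \<open>Left multiplication commutes with right translation, so one set controls the
  neighbourhoods of all translates of \<open>B\<close>.\<close>

lemma (in group) nbhd_r_coset:
  assumes "K \<subseteq> carrier G" "F \<subseteq> carrier G" "B \<subseteq> carrier G" "t \<in> carrier G"
  shows "nbhd K F (B #> t) \<subseteq> nbhd K F B #> t"
proof
  fix g assume "g \<in> nbhd K F (B #> t)"
  then consider k where "g \<in> carrier G" "k \<in> K" "k \<otimes> g \<in> B #> t" | "g \<in> F <#> (B #> t)"
    by (auto simp: nbhd_def)
  then show "g \<in> nbhd K F B #> t"
  proof cases
    case 1
    then obtain b where b: "b \<in> B" "k \<otimes> g = b \<otimes> t" by (auto simp: r_coset_def)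
    have kb: "k \<in> carrier G" "b \<in> carrier G" using 1 b assms by auto
    have "k \<otimes> (g \<otimes> inv t) = b"
      using b(2) kb 1(1) assms(4) by (metis inv_closed inv_solve_right m_assoc m_closed)
    then have "g \<otimes> inv t \<in> nbhd K F B"
      using 1 b(1) kb assms by (auto simp: nbhd_def)
    moreover have "g = (g \<otimes> inv t) \<otimes> t" using 1 assms by (simp add: m_assoc)
    ultimately show ?thesis unfolding r_coset_def by blast
  next
    case 2
    then have "g \<in> (F <#> B) #> t" using setmult_rcos_assoc[of F B t] assms by simp
    then show ?thesis by (auto simp: nbhd_def r_coset_def)
  qed
qed

section \<open>Compact metric actions and uniform versions of minimality and expansivity\<close>

locale compact_metric_action = group G + group_action G M \<phi> + Metric_space M d
  for G :: "('g, 'm) monoid_scheme" (structure)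
    and M :: "'x set" and \<phi> :: "'g \<Rightarrow> 'x \<Rightarrow> 'x" and d :: "'x \<Rightarrow> 'x \<Rightarrow> real" +
  assumes compact: "compact_space mtopology"
    and cont: "g \<in> carrier G \<Longrightarrow> continuous_map mtopology mtopology (\<phi> g)"
begin

lemma act_closed [simp, intro]: "g \<in> carrier G \<Longrightarrow> x \<in> M \<Longrightarrow> \<phi> g x \<in> M"
  using element_image by blast

lemma act_one [simp]: "x \<in> M \<Longrightarrow> \<phi> \<one> x = x"
  by (metis id_eq_one restrict_apply')

lemma dist_triangle: "x \<in> M \<Longrightarrow> y \<in> M \<Longrightarrow> z \<in> M \<Longrightarrow> d x z \<le> d y x + d y z"
  by (metis triangle commute)

lemma dist_along_le_iff:
  assumes "0 \<le> e"
  shows "dist_along d \<phi> K x y \<le> ennreal e \<longleftrightarrow> (\<forall>g\<in>K. d (\<phi> g x) (\<phi> g y) \<le> e)"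
  using assms by (simp add: dist_along_def SUP_le_iff ennreal_le_iff)

lemma memory_setE:
  assumes "memory_set G mtopology d \<phi> \<epsilon> \<delta> B A" "0 < \<epsilon>" "0 < \<delta>" "x \<in> M" "y \<in> M"
    and "\<And>g. g \<in> B - A \<Longrightarrow> d (\<phi> g x) (\<phi> g y) \<le> \<delta>"
  obtains z where "z \<in> M" "\<And>g. g \<in> B \<Longrightarrow> d (\<phi> g x) (\<phi> g z) \<le> \<epsilon>"
    "\<And>g. g \<in> carrier G - A \<Longrightarrow> d (\<phi> g y) (\<phi> g z) \<le> \<epsilon>"
proof -
  have "\<forall>g\<in>B - A. d (\<phi> g x) (\<phi> g y) \<le> \<delta>" using assms(6) by blast
  then have "\<exists>z\<in>M. (\<forall>g\<in>B. d (\<phi> g x) (\<phi> g z) \<le> \<epsilon>) \<and>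
      (\<forall>g\<in>carrier G - A. d (\<phi> g y) (\<phi> g z) \<le> \<epsilon>)"
    using assms(1-5) by (simp add: memory_set_def dist_along_le_iff)
  then show thesis using that by blast
qed

lemma openin_dist_less:
  assumes "finite W" "W \<subseteq> carrier G" "p \<in> M"
  shows "openin mtopology {y \<in> M. \<forall>w\<in>W. d (\<phi> w p) (\<phi> w y) < r}"
proof -
  have "openin mtopology {y \<in> topspace mtopology. \<phi> w y \<in> mball (\<phi> w p) r}" if "w \<in> W" for w
    using that assms cont by (intro openin_continuous_map_preimage[of _ mtopology]) auto
  moreover have "{y \<in> topspace mtopology. \<phi> w y \<in> mball (\<phi> w p) r} = {y \<in> M. d (\<phi> w p) (\<phi> w y) < r}"
    if "w \<in> W" for w
    using that assms by auto
  ultimately have op: "openin mtopology {y \<in> M. d (\<phi> w p) (\<phi> w y) < r}" if "w \<in> W" for w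
    using that by simp
  show ?thesis
  proof (cases "W = {}")
    case True
    then show ?thesis using openin_topspace[of mtopology] by simp
  next
    case False
    have "{y \<in> M. \<forall>w\<in>W. d (\<phi> w p) (\<phi> w y) < r} = (\<Inter>w\<in>W. {y \<in> M. d (\<phi> w p) (\<phi> w y) < r})"
      using False by auto
    then show ?thesis using op False assms(1) by (simp add: openin_INT2)
  qed
qed

text \<open>The points whose orbit never meets \<open>U\<close> form a closed invariant set, which
  minimality makes empty; compactness then leaves finitely many return times.\<close>

lemma minimal_finite_return:
  assumes min: "minimal_action G mtopology \<phi>" and U: "openin mtopology U" "U \<noteq> {}"
  obtains J where "finite J" "J \<subseteq> carrier G" "\<And>x. x \<in> M \<Longrightarrow> \<exists>g\<in>J. \<phi> g x \<in> U"
proof -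
  define P where "P g = {x \<in> M. \<phi> g x \<in> U}" for g
  have op: "openin mtopology (P g)" if "g \<in> carrier G" for g
    using openin_continuous_map_preimage[OF cont[OF that] U(1)] by (simp add: P_def)
  define C where "C = M - (\<Union>g\<in>carrier G. P g)"
  have cl: "closedin mtopology C"
    unfolding C_def using op by (intro closedin_diff) (auto intro: closedin_topspace[of mtopology, simplified])
  have "\<phi> h ` C \<subseteq> C" if h: "h \<in> carrier G" for h
  proof
    fix y assume "y \<in> \<phi> h ` C"
    then obtain x where x: "x \<in> M" "y = \<phi> h x" "\<And>g. g \<in> carrier G \<Longrightarrow> \<phi> g x \<notin> U"
      by (auto simp: C_def P_def)
    have "\<phi> g y \<notin> U" if "g \<in> carrier G" for g
      using x(3)[of "g \<otimes> h"] that h x by (simp add: composition_rule)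
    then show "y \<in> C" using x h by (auto simp: C_def P_def)
  qed
  then have "C = M \<or> C = {}" using min cl by (simp add: minimal_action_def)
  moreover have "C \<noteq> M"
  proof -
    obtain u where u: "u \<in> U" using U by auto
    then have "u \<in> M" using U(1) openin_subset by fastforce
    then have "u \<in> P \<one>" using u by (simp add: P_def)
    then show ?thesis using \<open>u \<in> M\<close> by (auto simp: C_def)
  qed
  ultimately have "M \<subseteq> \<Union>(P ` carrier G)" by (auto simp: C_def)
  moreover have "\<forall>V\<in>P ` carrier G. openin mtopology V" using op by blast
  ultimately obtain \<F> where "finite \<F>" "\<F> \<subseteq> P ` carrier G" "M \<subseteq> \<Union>\<F>"
    using compact unfolding compact_space_alt topspace_mtopology by meson
  then obtain J where J: "J \<subseteq> carrier G" "finite J" "\<F> = P ` J"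
    by (meson finite_subset_image)
  show thesis
    using J \<open>M \<subseteq> \<Union>\<F>\<close> by (intro that[of J]) (auto simp: P_def)
qed

text \<open>On the compact square, the pairs closer than \<open>\<eta>\<close> and the pairs
  separated by some \<open>g\<close> form an open cover; a finite subcover yields the window
  \<open>K\<close>.\<close>

lemma expansive_finite_window:
  assumes c: "\<And>x y. x \<in> M \<Longrightarrow> y \<in> M \<Longrightarrow> x \<noteq> y \<Longrightarrow> \<exists>g\<in>carrier G. d (\<phi> g x) (\<phi> g y) > c"
    and "0 < \<eta>"
  obtains K where "finite K" "K \<subseteq> carrier G" "\<one> \<in> K"
    "\<And>x y. x \<in> M \<Longrightarrow> y \<in> M \<Longrightarrow> (\<And>k. k \<in> K \<Longrightarrow> d (\<phi> k x) (\<phi> k y) \<le> c) \<Longrightarrow> d x y \<le> \<eta>"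
proof -
  let ?P = "prod_topology mtopology mtopology"
  have contd: "continuous_map ?P euclideanreal (\<lambda>z. d (\<phi> g (fst z)) (\<phi> g (snd z)))"
    if "g \<in> carrier G" for g
  proof -
    have "continuous_map ?P (mtopology_of (metric (M, d))) (\<lambda>z. \<phi> g (fst z))"
      and "continuous_map ?P (mtopology_of (metric (M, d))) (\<lambda>z. \<phi> g (snd z))"
      using continuous_map_compose[OF continuous_map_fst cont[OF that]]
        continuous_map_compose[OF continuous_map_snd cont[OF that]]
      by (simp_all add: o_def mtopology_of)
    then have "continuous_map ?P euclideanreal (\<lambda>z. mdist (metric (M, d)) (\<phi> g (fst z)) (\<phi> g (snd z)))"
      by (rule continuous_map_mdist)
    then show ?thesis by simp
  qed
  define O1 where "O1 g = {z \<in> M \<times> M. d (\<phi> g (fst z)) (\<phi> g (snd z)) > c}" for g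
  define O2 where "O2 = {z \<in> M \<times> M. d (\<phi> \<one> (fst z)) (\<phi> \<one> (snd z)) < \<eta>}"
  have op1: "openin ?P (O1 g)" if "g \<in> carrier G" for g
    using openin_continuous_map_preimage[OF contd[OF that], of "{c<..}"] by (simp add: O1_def)
  have op2: "openin ?P O2"
    using openin_continuous_map_preimage[OF contd[OF one_closed], of "{..<\<eta>}"] by (simp add: O2_def)
  have cov: "topspace ?P \<subseteq> \<Union>(insert O2 (O1 ` carrier G))"
  proof
    fix z assume "z \<in> topspace ?P"
    then have z: "fst z \<in> M" "snd z \<in> M" by auto
    show "z \<in> \<Union>(insert O2 (O1 ` carrier G))"
    proof (cases "fst z = snd z")
      case True
      then have "z \<in> O2" using z \<open>0 < \<eta>\<close> by (auto simp: O2_def mem_Times_iff)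
      then show ?thesis by auto
    next
      case False
      then obtain g where "g \<in> carrier G" "d (\<phi> g (fst z)) (\<phi> g (snd z)) > c" using c z by blast
      then have "z \<in> O1 g" using z by (auto simp: O1_def mem_Times_iff)
      then show ?thesis using \<open>g \<in> carrier G\<close> by auto
    qed
  qed
  have ops: "\<forall>V\<in>insert O2 (O1 ` carrier G). openin ?P V" using op1 op2 by blast
  have "compact_space ?P" using compact by (simp add: compact_space_prod_topology)
  then obtain \<F> where \<F>: "finite \<F>" "\<F> \<subseteq> insert O2 (O1 ` carrier G)" "topspace ?P \<subseteq> \<Union>\<F>"
    using cov ops unfolding compact_space_alt by meson
  have "finite (\<F> - {O2})" "\<F> - {O2} \<subseteq> O1 ` carrier G" using \<F> by auto
  then obtain J where J: "J \<subseteq> carrier G" "finite J" "\<F> - {O2} = O1 ` J"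
    by (meson finite_subset_image)
  show thesis
  \<comment> \<open>Enlarging the window only strengthens the closeness assumed on it.\<close>
  proof (rule that[of "insert \<one> J"])
    fix x y assume xy: "x \<in> M" "y \<in> M" "\<And>k. k \<in> insert \<one> J \<Longrightarrow> d (\<phi> k x) (\<phi> k y) \<le> c"
    then have "(x, y) \<notin> O1 g" if "g \<in> J" for g using that by (force simp: O1_def)
    moreover have "(x, y) \<in> \<Union>\<F>" using \<F>(3) xy by auto
    ultimately have "(x, y) \<in> O2" using J(3) by auto
    then show "d x y \<le> \<eta>" using xy by (simp add: O2_def)
  qed (use J in auto)
qed

section \<open>Gluing finitely many orbit pieces\<close>

text \<open>The error stays below \<open>2 * \<epsilon>\<close> however many pieces are inserted: after each insertion
  expansivity improves the bound \<open>3 * \<epsilon>\<close>, because on every window \<open>K g\<close> the glued point shadows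
  an actual orbit, that of \<open>x\<close> or of \<open>x\<close> modified along a single \<open>B j\<close>.\<close>

lemma glue_finite_family:
  assumes mem: "\<And>A. finite A \<Longrightarrow> A \<subseteq> carrier G \<Longrightarrow> memory_set G mtopology d \<phi> \<epsilon> \<delta> (F <#> A) A"
    and F: "F \<subseteq> carrier G" "\<one> \<in> F"
    and K: "K \<subseteq> carrier G" "\<one> \<in> K"
    and pos: "0 < \<epsilon>" "0 < \<delta>" and \<eta>: "\<eta> \<le> \<epsilon>" "\<eta> \<le> \<delta> / 2"
    and exp: "\<And>x y. x \<in> M \<Longrightarrow> y \<in> M \<Longrightarrow> (\<And>k. k \<in> K \<Longrightarrow> d (\<phi> k x) (\<phi> k y) \<le> 4 * \<epsilon>) \<Longrightarrow> d x y \<le> \<eta>"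
    and I: "finite I" and x: "x \<in> M"
    and B: "\<And>i. i \<in> I \<Longrightarrow> finite (B i) \<and> B i \<subseteq> carrier G"
    and y: "\<And>i. i \<in> I \<Longrightarrow> y i \<in> M"
    and bd: "\<And>i g. i \<in> I \<Longrightarrow> g \<in> (F <#> B i) - B i \<Longrightarrow> d (\<phi> g (y i)) (\<phi> g x) \<le> \<delta> / 2"
    and disj: "disjoint_family_on (\<lambda>i. nbhd K F (B i)) I"
  shows "\<exists>z\<in>M. (\<forall>i\<in>I. \<forall>g\<in>B i. d (\<phi> g (y i)) (\<phi> g z) \<le> 2 * \<epsilon>) \<and>
    (\<forall>g\<in>carrier G - (\<Union>i\<in>I. B i). d (\<phi> g x) (\<phi> g z) \<le> 2 * \<epsilon>)"
  using I B y bd disj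
proof (induction I rule: finite_induct)
  case empty
  show ?case using x pos by (intro bexI[of _ x]) auto
next
  case (insert i I)
  have "disjoint_family_on (\<lambda>i. nbhd K F (B i)) I"
    using insert.prems(4) by (auto simp: disjoint_family_on_def)
  then obtain z where z: "z \<in> M" "\<And>j g. j \<in> I \<Longrightarrow> g \<in> B j \<Longrightarrow> d (\<phi> g (y j)) (\<phi> g z) \<le> 2 * \<epsilon>"
    "\<And>g. g \<in> carrier G \<Longrightarrow> g \<notin> (\<Union>j\<in>I. B j) \<Longrightarrow> d (\<phi> g x) (\<phi> g z) \<le> 2 * \<epsilon>"
    using insert.IH insert.prems by (auto simp del: UN_iff)
  have B: "finite (B j)" "B j \<subseteq> carrier G" and y: "y j \<in> M" if "j \<in> insert i I" for j
    using insert.prems that by auto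
  have bd: "d (\<phi> g (y j)) (\<phi> g x) \<le> \<delta> / 2" if "j \<in> insert i I" "g \<in> (F <#> B j) - B j" for j g
    using insert.prems(3) that by blast
  have same: "j = j'" if "j \<in> insert i I" "j' \<in> insert i I" "g \<in> nbhd K F (B j)" "g \<in> nbhd K F (B j')" for j j' g
    using insert.prems(4) that unfolding disjoint_family_on_def by blast
  have sub: "g \<in> nbhd K F (B j)" if "j \<in> insert i I" "g \<in> B j" for j g
    using that B[of j] K by (force simp: nbhd_def)
  have near: "g \<in> nbhd K F (B j)" if "g \<in> carrier G" "k \<in> K" "k \<otimes> g \<in> B j" for g k j
    using that by (auto simp: nbhd_def)
  have FB: "g \<in> carrier G" if "j \<in> insert i I" "g \<in> F <#> B j" for g j
    using set_mult_closed[OF F(1) B(2)[OF that(1)]] that(2) by blast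
  have BF: "g \<in> F <#> B j" if "j \<in> insert i I" "g \<in> B j" for g j
    using subset_set_mult[OF F(2) B(2)[OF that(1)]] that(2) by blast
  \<comment> \<open>Expansivity at the place \<open>g\<close>: closeness
    \<open>4 * \<epsilon>\<close> along the window \<open>K g\<close> improves to
    \<open>\<eta>\<close> at \<open>g\<close>.\<close>
  have shift: "d (\<phi> g u) (\<phi> g v) \<le> \<eta>"
    if "u \<in> M" "v \<in> M" "g \<in> carrier G" "\<And>k. k \<in> K \<Longrightarrow> d (\<phi> (k \<otimes> g) u) (\<phi> (k \<otimes> g) v) \<le> 4 * \<epsilon>" for u v g
    using that K by (intro exp) (auto simp: composition_rule[symmetric] subset_iff)
  \<comment> \<open>Reference points \<open>s j\<close>: \<open>x\<close> modified along the single
    set \<open>B j\<close>, with error only \<open>\<epsilon>\<close>.\<close>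
  have "\<exists>s. s \<in> M \<and> (\<forall>g\<in>B j. d (\<phi> g (y j)) (\<phi> g s) \<le> \<epsilon>) \<and>
      (\<forall>g\<in>carrier G - B j. d (\<phi> g x) (\<phi> g s) \<le> \<epsilon>)" if j: "j \<in> insert i I" for j
  proof -
    have b: "\<And>g. g \<in> (F <#> B j) - B j \<Longrightarrow> d (\<phi> g (y j)) (\<phi> g x) \<le> \<delta>" using bd[OF j] pos by fastforce
    show ?thesis
      by (rule memory_setE[OF mem[of "B j"], OF B(1)[OF j] B(2)[OF j] pos y[OF j] x b]) 
        (use BF[OF j] in auto)
  qed
  then obtain s where s: "\<And>j. j \<in> insert i I \<Longrightarrow> s j \<in> M"
    "\<And>j g. j \<in> insert i I \<Longrightarrow> g \<in> B j \<Longrightarrow> d (\<phi> g (y j)) (\<phi> g (s j)) \<le> \<epsilon>"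
    "\<And>j g. j \<in> insert i I \<Longrightarrow> g \<in> carrier G \<Longrightarrow> g \<notin> B j \<Longrightarrow> d (\<phi> g x) (\<phi> g (s j)) \<le> \<epsilon>"
    by (metis DiffI)
  \<comment> \<open>Next to \<open>B i\<close> the point \<open>z\<close> still follows
    \<open>x\<close>: windows there miss all earlier regions, so the distance is at most
    \<open>\<eta>\<close>, hence \<open>\<delta> / 2\<close>. The other \<open>\<delta> / 2\<close>
    pays for the gap between \<open>y i\<close> and \<open>x\<close>.\<close>
  have zb: "d (\<phi> g (y i)) (\<phi> g z) \<le> \<delta>" if g: "g \<in> (F <#> B i) - B i" for g
  proof -
    have gc: "g \<in> carrier G" "g \<in> nbhd K F (B i)" using g FB[of i g] by (auto simp: nbhd_def)
    have "d (\<phi> g x) (\<phi> g z) \<le> \<eta>"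
    proof (rule shift[OF x z(1) gc(1)])
      fix k assume k: "k \<in> K"
      have "k \<otimes> g \<notin> B j" if "j \<in> I" for j
        using same[of j i g] near[OF gc(1) k, of j] gc that insert.hyps by auto
      then show "d (\<phi> (k \<otimes> g) x) (\<phi> (k \<otimes> g) z) \<le> 4 * \<epsilon>"
        using z(3)[of "k \<otimes> g"] k K gc pos by fastforce
    qed
    moreover have "d (\<phi> g (y i)) (\<phi> g x) \<le> \<delta> / 2" using bd g by auto
    moreover have "d (\<phi> g (y i)) (\<phi> g z) \<le> d (\<phi> g (y i)) (\<phi> g x) + d (\<phi> g x) (\<phi> g z)"
      using gc x y z by (intro triangle) auto
    ultimately show ?thesis using \<eta> by linarith
  qed
  obtain w where w: "w \<in> M" "\<And>g. g \<in> F <#> B i \<Longrightarrow> d (\<phi> g (y i)) (\<phi> g w) \<le> \<epsilon>"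
    "\<And>g. g \<in> carrier G - B i \<Longrightarrow> d (\<phi> g z) (\<phi> g w) \<le> \<epsilon>"
    by (rule memory_setE[OF mem[of "B i"], OF B(1) B(2) pos y z(1) zb]) auto
  \<comment> \<open>First the naive accumulated bound \<open>2 * \<epsilon> + \<epsilon>\<close>, on
    the regions and then off them.\<close>
  have weak1: "d (\<phi> g (y j)) (\<phi> g w) \<le> 3 * \<epsilon>" if j: "j \<in> insert i I" and g: "g \<in> B j" for j g
  proof (cases "j = i")
    case True
    then show ?thesis using w(2)[OF BF[of i g]] g pos by auto
  next
    case False
    then have "g \<notin> B i" using same[of j i g] sub j g by auto
    then have "d (\<phi> g z) (\<phi> g w) \<le> \<epsilon>" using w(3) g B[OF j] by auto
    moreover have "d (\<phi> g (y j)) (\<phi> g z) \<le> 2 * \<epsilon>" using z(2) g j False by auto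
    moreover have "d (\<phi> g (y j)) (\<phi> g w) \<le> d (\<phi> g (y j)) (\<phi> g z) + d (\<phi> g z) (\<phi> g w)"
      using g B[OF j] y[OF j] z w by (intro triangle) auto
    ultimately show ?thesis by linarith
  qed
  have weak2: "d (\<phi> g x) (\<phi> g w) \<le> 3 * \<epsilon>" if g: "g \<in> carrier G" "\<And>j. j \<in> insert i I \<Longrightarrow> g \<notin> B j" for g
  proof -
    have "d (\<phi> g z) (\<phi> g w) \<le> \<epsilon>" using w(3) g by auto
    moreover have "d (\<phi> g x) (\<phi> g z) \<le> 2 * \<epsilon>" using z(3) g by auto
    moreover have "d (\<phi> g x) (\<phi> g w) \<le> d (\<phi> g x) (\<phi> g z) + d (\<phi> g z) (\<phi> g w)"
      using g x z w by (intro triangle) auto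
    ultimately show ?thesis by linarith
  qed
  \<comment> \<open>The window at \<open>g\<close> meets no region other than \<open>B j\<close>.
    Along it, \<open>s j\<close> and \<open>w\<close> both follow \<open>y j\<close> inside
    \<open>B j\<close> and \<open>x\<close> outside, with errors \<open>\<epsilon>\<close> and
    \<open>3 * \<epsilon>\<close>; these add up to the \<open>4 * \<epsilon>\<close> that
    \<open>shift\<close> tolerates.\<close>
  have single: "d (\<phi> g (s j)) (\<phi> g w) \<le> \<epsilon>" if j: "j \<in> insert i I" and g: "g \<in> carrier G" "g \<in> nbhd K F (B j)" for j g
  proof -
    have "d (\<phi> g (s j)) (\<phi> g w) \<le> \<eta>"
    proof (rule shift[OF s(1)[OF j] w(1) g(1)])
      fix k assume k: "k \<in> K"
      then have kg: "k \<otimes> g \<in> carrier G" using K g by auto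
      show "d (\<phi> (k \<otimes> g) (s j)) (\<phi> (k \<otimes> g) w) \<le> 4 * \<epsilon>"
      proof (cases "k \<otimes> g \<in> B j")
        case True
        then have "d (\<phi> (k \<otimes> g) (s j)) (\<phi> (k \<otimes> g) w)
            \<le> d (\<phi> (k \<otimes> g) (y j)) (\<phi> (k \<otimes> g) (s j)) + d (\<phi> (k \<otimes> g) (y j)) (\<phi> (k \<otimes> g) w)"
          using kg s(1)[OF j] y[OF j] w by (intro dist_triangle) auto
        then show ?thesis using s(2)[OF j True] weak1[OF j True] by linarith
      next
        case False
        have "k \<otimes> g \<notin> B j'" if "j' \<in> insert i I" for j'
          using same[OF j that g(2)] near[OF g(1) k, of j'] False by auto
        then have "d (\<phi> (k \<otimes> g) x) (\<phi> (k \<otimes> g) w) \<le> 3 * \<epsilon>" using weak2 kg by blast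
        moreover have "d (\<phi> (k \<otimes> g) (s j)) (\<phi> (k \<otimes> g) w)
            \<le> d (\<phi> (k \<otimes> g) x) (\<phi> (k \<otimes> g) (s j)) + d (\<phi> (k \<otimes> g) x) (\<phi> (k \<otimes> g) w)"
          using kg s(1)[OF j] x w by (intro dist_triangle) auto
        ultimately show ?thesis using s(3)[OF j kg False] by linarith
      qed
    qed
    then show ?thesis using \<eta> by linarith
  qed
  \<comment> \<open>Passing through \<open>s j\<close> costs \<open>\<epsilon> + \<epsilon>\<close>,
    which restores the bound of the induction. Where the window meets no region, \<open>w\<close> is
    compared with \<open>x\<close> directly.\<close>
  show ?case
  proof (intro bexI[of _ w] conjI ballI)
    fix j g assume j: "j \<in> insert i I" and g: "g \<in> B j"
    have gc: "g \<in> carrier G" using g B[OF j] by auto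
    have "d (\<phi> g (y j)) (\<phi> g w) \<le> d (\<phi> g (y j)) (\<phi> g (s j)) + d (\<phi> g (s j)) (\<phi> g w)"
      using gc s(1)[OF j] y[OF j] w by (intro triangle) auto
    then show "d (\<phi> g (y j)) (\<phi> g w) \<le> 2 * \<epsilon>"
      using s(2)[OF j g] single[OF j gc sub[OF j g]] by linarith
  next
    fix g assume g: "g \<in> carrier G - (\<Union>j\<in>insert i I. B j)"
    then have gc: "g \<in> carrier G" by auto
    show "d (\<phi> g x) (\<phi> g w) \<le> 2 * \<epsilon>"
    proof (cases "\<exists>j\<in>insert i I. g \<in> nbhd K F (B j)")
      case True
      then obtain j where j: "j \<in> insert i I" "g \<in> nbhd K F (B j)" by blast
      have "d (\<phi> g x) (\<phi> g w) \<le> d (\<phi> g x) (\<phi> g (s j)) + d (\<phi> g (s j)) (\<phi> g w)"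
        using gc s(1)[OF j(1)] x w by (intro triangle) auto
      moreover have "g \<notin> B j" using g j(1) by blast
      ultimately show ?thesis
        using s(3)[OF j(1) gc] single[OF j(1) gc j(2)] by linarith
    next
      case False
      have "d (\<phi> g x) (\<phi> g w) \<le> \<eta>"
      proof (rule shift[OF x w(1) gc])
        fix k assume k: "k \<in> K"
        have "k \<otimes> g \<notin> B j" if "j \<in> insert i I" for j using near[OF gc k] that False by blast
        then show "d (\<phi> (k \<otimes> g) x) (\<phi> (k \<otimes> g) w) \<le> 4 * \<epsilon>"
          using weak2[of "k \<otimes> g"] k K gc pos by fastforce
      qed
      then show ?thesis using \<eta> pos by linarith
    qed
  qed (rule w(1))
qed

section \<open>Rigidity from the boundary\<close>

text \<open>If \<open>p\<close> and \<open>q\<close> agree near the boundary of \<open>A\<close> but not on \<open>A\<close>, every approximate occurrence of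
  \<open>p\<close> along \<open>A\<close> may be replaced by \<open>q\<close>. Group the occurrences in the orbit of \<open>p\<close> into blocks of
  \<open>k\<close>; an occurrence of \<open>p\<close> along a large window \<open>W\<close> at \<open>g\<close> forces all \<open>k\<close> choices in some block near
  \<open>g\<close>. As only \<open>O(k\<^sup>2)\<close> positions \<open>g\<close> are near a given block, one of its \<open>2\<^sup>k\<close> replacements
  contradicts all of them, which yields points whose orbits stay away from \<open>p\<close>.\<close>

theorem boundary_rigidity:
  assumes inf: "infinite (carrier G)"
    and min: "minimal_action G mtopology \<phi>"
    and exp: "expansive_action G mtopology d \<phi>"
    and markov: "strong_topological_Markov_property G mtopology d \<phi>"
    and r: "0 < (r::real)"
  obtains \<delta> F where "0 < \<delta>" "finite F" "F \<subseteq> carrier G" "\<one> \<in> F"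
    "\<And>A p q a. finite A \<Longrightarrow> A \<subseteq> carrier G \<Longrightarrow> p \<in> M \<Longrightarrow> q \<in> M \<Longrightarrow>
      (\<And>g. g \<in> (F <#> A) - A \<Longrightarrow> d (\<phi> g p) (\<phi> g q) \<le> \<delta>) \<Longrightarrow> a \<in> A \<Longrightarrow> d (\<phi> a p) (\<phi> a q) \<le> r"
proof -
  obtain c where c: "c > 0"
    "\<And>x y. x \<in> M \<Longrightarrow> y \<in> M \<Longrightarrow> x \<noteq> y \<Longrightarrow> \<exists>g\<in>carrier G. d (\<phi> g x) (\<phi> g y) > c"
    using exp unfolding expansive_action_def topspace_mtopology by meson
  \<comment> \<open>The gluing error \<open>2 * \<epsilon>\<close> must be small against
    \<open>r\<close>, and \<open>4 * \<epsilon>\<close> must not exceed the expansivity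
    constant.\<close>
  define \<epsilon> where "\<epsilon> = min (r / 16) (c / 4)"
  have \<epsilon>: "0 < \<epsilon>" "2 * \<epsilon> \<le> r / 8" "4 * \<epsilon> \<le> c" using r c by (auto simp: \<epsilon>_def)
  obtain \<delta> F where \<delta>: "0 < \<delta>" and F: "finite F" "F \<subseteq> carrier G" "\<one> \<in> F"
    and mem: "\<And>A. finite A \<Longrightarrow> A \<subseteq> carrier G \<Longrightarrow> memory_set G mtopology d \<phi> \<epsilon> \<delta> (F <#> A) A"
    using markov \<epsilon>(1) unfolding strong_topological_Markov_property_def by meson
  \<comment> \<open>Two errors \<open>\<theta>\<close> add up in the boundary condition for gluing,
    which allows \<open>\<delta> / 2\<close>.\<close>
  define \<theta> where "\<theta> = min (\<delta> / 4) (r / 16)"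
  have \<theta>: "0 < \<theta>" "\<theta> \<le> \<delta> / 4" "\<theta> \<le> r / 16" using r \<delta> by (auto simp: \<theta>_def)
  define \<eta> where "\<eta> = min \<epsilon> (\<delta> / 2)"
  have \<eta>: "0 < \<eta>" "\<eta> \<le> \<epsilon>" "\<eta> \<le> \<delta> / 2" using \<epsilon> \<delta> by (auto simp: \<eta>_def)
  obtain K where K: "finite K" "K \<subseteq> carrier G" "\<one> \<in> K"
    and Kc: "\<And>x y. x \<in> M \<Longrightarrow> y \<in> M \<Longrightarrow> (\<And>k. k \<in> K \<Longrightarrow> d (\<phi> k x) (\<phi> k y) \<le> c) \<Longrightarrow> d x y \<le> \<eta>"
  proof (rule expansive_finite_window[of c \<eta>])
    fix x y assume "x \<in> M" "y \<in> M" "x \<noteq> y"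
    then show "\<exists>g\<in>carrier G. c < d (\<phi> g x) (\<phi> g y)" by (rule c(2))
  next
    fix K assume "finite K" "K \<subseteq> carrier G" "\<one> \<in> K"
      "\<And>x y. x \<in> M \<Longrightarrow> y \<in> M \<Longrightarrow> (\<And>k. k \<in> K \<Longrightarrow> d (\<phi> k x) (\<phi> k y) \<le> c) \<Longrightarrow> d x y \<le> \<eta>"
    then show thesis by (rule that)
  qed (rule \<eta>(1))
  have K\<epsilon>: "d x y \<le> \<eta>" if "x \<in> M" "y \<in> M" "\<And>k. k \<in> K \<Longrightarrow> d (\<phi> k x) (\<phi> k y) \<le> 4 * \<epsilon>" for x y
  proof (rule Kc[OF that(1,2)])
    show "d (\<phi> k x) (\<phi> k y) \<le> c" if "k \<in> K" for k
      using \<open>\<And>k. k \<in> K \<Longrightarrow> d (\<phi> k x) (\<phi> k y) \<le> 4 * \<epsilon>\<close>[OF that] \<epsilon>(3) by linarith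
  qed
  show thesis
  proof (rule that[of \<theta> F])
    fix A p q a0
    assume A: "finite A" "A \<subseteq> carrier G" and p: "p \<in> M" and q: "q \<in> M" and a0: "a0 \<in> A"
      and pq: "\<And>g. g \<in> (F <#> A) - A \<Longrightarrow> d (\<phi> g p) (\<phi> g q) \<le> \<theta>"
    show "d (\<phi> a0 p) (\<phi> a0 q) \<le> r"
    proof (rule ccontr)
      assume far: "\<not> ?thesis"
      have FA: "finite (F <#> A)" "F <#> A \<subseteq> carrier G" "A \<subseteq> F <#> A"
      proof -
        show "finite (F <#> A)" using F A by (auto simp: set_mult_def)
        show "F <#> A \<subseteq> carrier G" using F(2) A(2) by (rule set_mult_closed)
        show "A \<subseteq> F <#> A" using F(3) A(2) by (rule subset_set_mult)
      qed
      \<comment> \<open>A visit to \<open>U\<close> is an approximate occurrence of \<open>p\<close>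
        along \<open>A\<close> and its boundary; \<open>\<tau> g\<close> below is such an occurrence
        in the orbit of \<open>p\<close>, found in \<open>R #> g\<close>.\<close>
      define U where "U = {y \<in> M. \<forall>w\<in>F <#> A. d (\<phi> w p) (\<phi> w y) < \<theta>}"
      have "openin mtopology U" unfolding U_def using FA p by (intro openin_dist_less) auto
      moreover have "p \<in> U" using p FA \<theta> by (auto simp: U_def)
      ultimately obtain R where R: "finite R" "R \<subseteq> carrier G" "\<And>x. x \<in> M \<Longrightarrow> \<exists>g\<in>R. \<phi> g x \<in> U"
        using minimal_finite_return[OF min] by blast
      have "\<exists>t. t \<in> carrier G \<and> \<phi> t p \<in> U \<and> (\<exists>\<rho>\<in>R. t = \<rho> \<otimes> g)" if g: "g \<in> carrier G" for g
      proof -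
        obtain \<rho> where "\<rho> \<in> R" "\<phi> \<rho> (\<phi> g p) \<in> U" using R(3) g p by blast
        then show ?thesis using R(2) g p
          by (intro exI[of _ "\<rho> \<otimes> g"]) (auto simp: composition_rule subset_iff)
      qed
      then obtain \<tau> where \<tau>: "\<And>g. g \<in> carrier G \<Longrightarrow> \<tau> g \<in> carrier G"
        "\<And>g. g \<in> carrier G \<Longrightarrow> \<phi> (\<tau> g) p \<in> U"
        "\<And>g. g \<in> carrier G \<Longrightarrow> \<exists>\<rho>\<in>R. \<tau> g = \<rho> \<otimes> g" by metis
      define N where "N = nbhd K F A"
      have N: "finite N" "N \<subseteq> carrier G" "A \<subseteq> N"
        using finite_nbhd nbhd_subset_carrier F A K FA by (auto simp: N_def nbhd_def)
      \<comment> \<open>\<open>Q #> g\<close> contains the neighbourhood of the region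
        \<open>A #> \<tau> g\<close>, so the disjoint translates by \<open>H\<close> give
        \<open>k\<close> independent occurrences.\<close>
      define Q where "Q = N <#> R"
      have Q: "finite Q" "Q \<subseteq> carrier G" "Q \<noteq> {}"
        using N R a0 p set_mult_closed by (auto simp: Q_def set_mult_def)
      obtain k where k: "0 < k" "(card Q * k)\<^sup>2 < 2 ^ k"
        using quadratic_less_exponential by blast
      obtain H where H: "finite H" "H \<subseteq> carrier G" "card H = k" "disjoint_family_on (\<lambda>h. Q #> h) H"
        using infinite_disjoint_translates[OF inf Q(1,2), of k] by (elim exE conjE) (rule that)
      have "H \<noteq> {}" using H k by auto
      \<comment> \<open>\<open>E #> s\<close> is the footprint of the block at \<open>s\<close>,
        made of the occurrences \<open>\<tau> (h \<otimes> s)\<close> with \<open>h\<close> in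
        \<open>H\<close>.\<close>
      define E where "E = Q <#> H"
      have E: "finite E" "E \<subseteq> carrier G" "E \<noteq> {}"
        using Q H \<open>H \<noteq> {}\<close> set_mult_closed by (auto simp: E_def set_mult_def)
      have "E = (\<lambda>(a, b). a \<otimes> b) ` (Q \<times> H)" by (auto simp: E_def set_mult_def)
      then have cE: "card E \<le> card Q * k"
        using card_image_le[of "Q \<times> H" "\<lambda>(a, b). a \<otimes> b"] Q H by (simp add: card_cartesian_product)
      \<comment> \<open>If \<open>E #> g\<close> meets \<open>E #> s\<close>, then \<open>g\<close>
        and \<open>s\<close> differ by a left factor in \<open>D\<close>; so fewer than
        \<open>2 ^ k\<close> positions are near a given block.\<close>
      define D where "D = (\<lambda>(a, b). inv a \<otimes> b) ` (E \<times> E)"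
      have D: "finite D" "D \<subseteq> carrier G" using E by (auto simp: D_def)
      have "card D \<le> card E * card E"
        using card_image_le[of "E \<times> E" "\<lambda>(a, b). inv a \<otimes> b"] E by (simp add: D_def card_cartesian_product)
      also have "\<dots> \<le> (card Q * k)\<^sup>2" using mult_mono[OF cE cE] by (simp add: power2_eq_square)
      finally have cD: "card D < 2 ^ k" using k by simp
      have D_sym: "inv x \<in> D" if "x \<in> D" for x
        using that E by (force simp: D_def inv_mult_group subset_iff)
      \<comment> \<open>Large enough to see a whole block from nearby: if
        \<open>s = e \<otimes> g\<close> with \<open>e\<close> in \<open>D\<close>, then
        \<open>W #> g\<close> contains every \<open>a \<otimes> t (s, h)\<close>.\<close>
      define W where "W = A <#> (R <#> (H <#> D))"
      have W: "finite W" "W \<subseteq> carrier G"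
        using A R H D by (auto simp: W_def set_mult_def subset_iff)
      define U' where "U' = {y \<in> M. \<forall>w\<in>W. d (\<phi> w p) (\<phi> w y) < r / 16}"
      have "openin mtopology U'" unfolding U'_def using W p by (intro openin_dist_less)
      moreover have "p \<in> U'" using p W r by (auto simp: U'_def)
      ultimately obtain J where J: "finite J" "J \<subseteq> carrier G" "\<And>x. x \<in> M \<Longrightarrow> \<exists>g\<in>J. \<phi> g x \<in> U'"
        using minimal_finite_return[OF min] by blast
      obtain \<Sigma> where \<Sigma>: "\<Sigma> \<subseteq> J" "disjoint_family_on (\<lambda>s. E #> s) \<Sigma>"
        "\<And>g. g \<in> J \<Longrightarrow> \<exists>s\<in>\<Sigma>. (E #> g) \<inter> (E #> s) \<noteq> {}"
        using finite_disjoint_translates_net[OF J(1,2) E(3)] by metis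
      have \<Sigma>c: "s \<in> carrier G" if "s \<in> \<Sigma>" for s using that \<Sigma>(1) J(2) by auto
      have net: "\<exists>s\<in>\<Sigma>. \<exists>e\<in>D. s = e \<otimes> g" if g: "g \<in> J" for g
      proof -
        obtain s where s: "s \<in> \<Sigma>" "(E #> g) \<inter> (E #> s) \<noteq> {}" using \<Sigma>(3)[OF g] by blast
        then obtain a b where ab: "a \<in> E" "b \<in> E" "a \<otimes> g = b \<otimes> s" by (auto simp: r_coset_def)
        have "a \<in> carrier G" "b \<in> carrier G" "g \<in> carrier G" using ab E g J by auto
        then have "s = inv b \<otimes> a \<otimes> g"
          using ab(3) \<Sigma>c[OF s(1)] by (metis inv_closed inv_solve_left m_assoc m_closed)
        then show ?thesis using s ab by (force simp: D_def)
      qed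
      define t where "t = (\<lambda>(s, h). \<tau> (h \<otimes> s))"
      have tc: "t (s, h) \<in> carrier G" "\<phi> (t (s, h)) p \<in> U" if "s \<in> \<Sigma>" "h \<in> H" for s h
        using \<tau>(1,2)[of "h \<otimes> s"] that H \<Sigma>c by (auto simp: t_def)
      have tR: "\<exists>\<rho>\<in>R. t (s, h) = \<rho> \<otimes> (h \<otimes> s)" if "s \<in> \<Sigma>" "h \<in> H" for s h
        using \<tau>(3)[of "h \<otimes> s"] that H \<Sigma>c by (auto simp: t_def)
      define B where "B = (\<lambda>i. A #> t i)"
      have NB: "nbhd K F (B (s, h)) \<subseteq> (Q #> h) #> s" if sh: "s \<in> \<Sigma>" "h \<in> H" for s h
      proof
        fix g assume "g \<in> nbhd K F (B (s, h))"
        then have "g \<in> N #> t (s, h)"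
          using nbhd_r_coset[OF K(2) F(2) A(2) tc(1)[OF sh]] by (auto simp: B_def N_def)
        then obtain n where n: "n \<in> N" "g = n \<otimes> t (s, h)" by (auto simp: r_coset_def)
        obtain \<rho> where \<rho>: "\<rho> \<in> R" "t (s, h) = \<rho> \<otimes> (h \<otimes> s)" using tR[OF sh] by blast
        have cl: "n \<in> carrier G" "\<rho> \<in> carrier G" "h \<in> carrier G" "s \<in> carrier G"
          using n \<rho> N R H \<Sigma>c sh by auto
        have "g = ((n \<otimes> \<rho>) \<otimes> h) \<otimes> s" using n \<rho> cl by (simp add: m_assoc)
        moreover have "n \<otimes> \<rho> \<in> Q" using n \<rho> by (auto simp: Q_def set_mult_def)
        ultimately show "g \<in> (Q #> h) #> s" unfolding r_coset_def by blast
      qed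
      \<comment> \<open>Footprints separate different blocks, and the sets \<open>Q #> h\<close>
        separate occurrences within a block.\<close>
      have disj: "disjoint_family_on (\<lambda>i. nbhd K F (B i)) (\<Sigma> \<times> H)"
        unfolding disjoint_family_on_def
      proof (intro ballI impI)
        fix i j assume ij: "i \<in> \<Sigma> \<times> H" "j \<in> \<Sigma> \<times> H" "i \<noteq> j"
        obtain s h s' h' where eq: "i = (s, h)" "j = (s', h')" by (cases i, cases j) auto
        have sh: "s \<in> \<Sigma>" "h \<in> H" "s' \<in> \<Sigma>" "h' \<in> H" using ij eq by auto
        have "False" if g: "g \<in> (Q #> h) #> s" "g \<in> (Q #> h') #> s'" for g
        proof -
          obtain b b' where b: "b \<in> Q" "g = (b \<otimes> h) \<otimes> s" "b' \<in> Q" "g = (b' \<otimes> h') \<otimes> s'"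
            using g by (auto simp: r_coset_def)
          have cl: "b \<in> carrier G" "b' \<in> carrier G" "h \<in> carrier G" "h' \<in> carrier G"
            "s \<in> carrier G" "s' \<in> carrier G"
            using b sh Q H \<Sigma>c by auto
          have "b \<otimes> h \<in> E" "b' \<otimes> h' \<in> E" using b sh by (auto simp: E_def set_mult_def)
          then have "g \<in> E #> s" "g \<in> E #> s'" using b unfolding r_coset_def by blast+
          then have ss: "s = s'" using \<Sigma>(2) sh by (auto simp: disjoint_family_on_def)
          then have bh: "b \<otimes> h = b' \<otimes> h'" using b cl by (metis m_closed right_cancel)
          have "b \<otimes> h \<in> Q #> h" "b' \<otimes> h' \<in> Q #> h'" using b by (auto simp: r_coset_def)
          then have "h = h'" using bh H(4) sh by (auto simp: disjoint_family_on_def)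
          then show False using ss ij(3) eq by simp
        qed
        then show "nbhd K F (B i) \<inter> nbhd K F (B j) = {}"
          using NB sh eq by blast
      qed
      \<comment> \<open>If a glued point imitates \<open>p\<close> along \<open>W\<close> at
        \<open>g\<close>, its replacement pattern in the block at \<open>s\<close> must be this set,
        which is fixed before any replacement is chosen.\<close>
      define forced where "forced g s = {h \<in> H. \<forall>a\<in>A. d (\<phi> a q) (\<phi> (a \<otimes> t (s, h) \<otimes> inv g) p) \<le> r / 4}" for g s
      \<comment> \<open>Diagonal choice: \<open>\<omega> s\<close> differs from the patterns forced
        by all positions near \<open>s\<close>.\<close>
      have "\<exists>w. w \<subseteq> H \<and> w \<notin> (\<lambda>g. forced g s) ` ((\<lambda>e. e \<otimes> s) ` D)" for s
      proof (rule avoid_finite_family[OF H(1)])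
        have "card ((\<lambda>g. forced g s) ` ((\<lambda>e. e \<otimes> s) ` D)) \<le> card D"
          using D(1) by (metis card_image_le finite_imageI le_trans)
        then show "card ((\<lambda>g. forced g s) ` ((\<lambda>e. e \<otimes> s) ` D)) < 2 ^ card H"
          using cD H(3) by simp
      qed (use D in auto)
      then obtain \<omega> where \<omega>: "\<And>s. \<omega> s \<subseteq> H" "\<And>s. \<omega> s \<notin> (\<lambda>g. forced g s) ` ((\<lambda>e. e \<otimes> s) ` D)" by metis
      define I where "I = Sigma \<Sigma> \<omega>"
      have I: "I \<subseteq> \<Sigma> \<times> H" using \<omega>(1) by (auto simp: I_def)
      have finI: "finite I" using I J(1) \<Sigma>(1) H(1) by (meson finite_SigmaI finite_subset)
      have tI: "t i \<in> carrier G" "\<phi> (t i) p \<in> U" if "i \<in> \<Sigma> \<times> H" for i using that tc by auto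
      \<comment> \<open>The point \<open>\<phi> (inv (t i)) q\<close> shows at
        \<open>a \<otimes> t i\<close> what \<open>q\<close> shows at \<open>a\<close>.\<close>
      have "\<exists>z\<in>M. (\<forall>i\<in>I. \<forall>g\<in>B i. d (\<phi> g (\<phi> (inv (t i)) q)) (\<phi> g z) \<le> 2 * \<epsilon>) \<and>
          (\<forall>g\<in>carrier G - (\<Union>i\<in>I. B i). d (\<phi> g p) (\<phi> g z) \<le> 2 * \<epsilon>)"
      proof (rule glue_finite_family[OF mem F(2,3) K(2,3) \<epsilon>(1) \<delta> \<eta>(2,3) K\<epsilon> finI p])
        fix i assume i: "i \<in> I"
        then have ti: "t i \<in> carrier G" "\<phi> (t i) p \<in> U" using tI I by auto
        show "finite (B i) \<and> B i \<subseteq> carrier G"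
          using A ti by (auto simp: B_def r_coset_def)
        show "\<phi> (inv (t i)) q \<in> M" using ti q by auto
        fix g assume g: "g \<in> (F <#> B i) - B i"
        have "g \<in> (F <#> A) #> t i"
          using g setmult_rcos_assoc[of F A "t i"] F A ti by (simp add: B_def)
        then obtain f where f: "f \<in> F <#> A" "g = f \<otimes> t i" by (auto simp: r_coset_def)
        have fc: "f \<in> carrier G" using f FA by auto
        have "f \<notin> A" using g f by (auto simp: B_def r_coset_def)
        then have "d (\<phi> f p) (\<phi> f q) \<le> \<theta>" using pq f by auto
        moreover have "d (\<phi> f p) (\<phi> f (\<phi> (t i) p)) < \<theta>" using ti(2) f by (auto simp: U_def)
        moreover have "\<phi> g (\<phi> (inv (t i)) q) = \<phi> f q"
          using f fc ti q by (simp add: composition_rule[symmetric] m_assoc)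
        moreover have "\<phi> g p = \<phi> f (\<phi> (t i) p)" using f fc ti p by (simp add: composition_rule)
        moreover have "d (\<phi> f q) (\<phi> f (\<phi> (t i) p)) \<le> d (\<phi> f p) (\<phi> f q) + d (\<phi> f p) (\<phi> f (\<phi> (t i) p))"
          using fc ti p q by (intro dist_triangle) auto
        ultimately show "d (\<phi> g (\<phi> (inv (t i)) q)) (\<phi> g p) \<le> \<delta> / 2" using \<theta> by simp
      next
        show "disjoint_family_on (\<lambda>i. nbhd K F (B i)) I"
          using disj I by (meson disjoint_family_on_mono)
      qed
      then obtain z where z: "z \<in> M"
        "\<And>i g. i \<in> I \<Longrightarrow> g \<in> B i \<Longrightarrow> d (\<phi> g (\<phi> (inv (t i)) q)) (\<phi> g z) \<le> 2 * \<epsilon>"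
        "\<And>g. g \<in> carrier G - (\<Union>i\<in>I. B i) \<Longrightarrow> d (\<phi> g p) (\<phi> g z) \<le> 2 * \<epsilon>"
        by blast
      \<comment> \<open>Minimality brings \<open>z\<close> back near \<open>p\<close> along
        \<open>W\<close>, at a position near some block.\<close>
      obtain g where g: "g \<in> J" "\<phi> g z \<in> U'" using J(3) z(1) by blast
      have gc: "g \<in> carrier G" using g J by auto
      obtain s e where s: "s \<in> \<Sigma>" "e \<in> D" "s = e \<otimes> g" using net[OF g(1)] by blast
      have sc: "s \<in> carrier G" "e \<in> carrier G" using s(1,2) D \<Sigma>c by auto
      have "g = inv e \<otimes> s" using s sc gc by (simp add: m_assoc[symmetric])
      then have gD: "g \<in> (\<lambda>e. e \<otimes> s) ` D" using D_sym[OF s(2)] by blast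
      have window: "d (\<phi> (a \<otimes> t (s, h) \<otimes> inv g) p) (\<phi> (a \<otimes> t (s, h)) z) < r / 16"
        if h: "h \<in> H" and a: "a \<in> A" for h a
      proof -
        obtain \<rho> where \<rho>: "\<rho> \<in> R" "t (s, h) = \<rho> \<otimes> (h \<otimes> s)" using tR[OF s(1) h] by blast
        have cl: "a \<in> carrier G" "\<rho> \<in> carrier G" "h \<in> carrier G" using a \<rho> h A R H by auto
        define w where "w = a \<otimes> (\<rho> \<otimes> (h \<otimes> e))"
        have "w \<in> W"
          unfolding W_def w_def using a \<rho>(1) h s(2) by (intro set_multI)
        then have "d (\<phi> w p) (\<phi> w (\<phi> g z)) < r / 16" using g by (auto simp: U'_def)
        moreover have wc: "w \<in> carrier G" using cl sc by (auto simp: w_def)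
        moreover have "w \<otimes> g = a \<otimes> t (s, h)" using cl sc gc s \<rho> by (simp add: w_def m_assoc)
        moreover then have "w = a \<otimes> t (s, h) \<otimes> inv g"
          using wc gc cl tc(1)[OF s(1) h] by (metis inv_solve_right m_closed)
        ultimately show ?thesis using z gc by (simp add: composition_rule[symmetric])
      qed
      \<comment> \<open>A replaced occurrence shows \<open>q\<close> up to
        \<open>2 * \<epsilon> + r / 16\<close>, within \<open>r / 4\<close>. An unreplaced one shows
        \<open>p\<close>; were it forced as well, \<open>p\<close> and \<open>q\<close> would be
        within \<open>r\<close> at \<open>a0\<close>, against \<open>far\<close>.\<close>
      have "\<omega> s = forced g s"
      proof (intro equalityI subsetI)
        fix h assume h: "h \<in> \<omega> s"
        then have hH: "h \<in> H" and i: "(s, h) \<in> I" using \<omega>(1) s by (auto simp: I_def)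
        note t = tc[OF s(1) hH]
        have "d (\<phi> a q) (\<phi> (a \<otimes> t (s, h) \<otimes> inv g) p) \<le> r / 4" if a: "a \<in> A" for a
        proof -
          have ac: "a \<in> carrier G" using a A by auto
          have "a \<otimes> t (s, h) \<in> B (s, h)" using a by (auto simp: B_def r_coset_def)
          then have "d (\<phi> (a \<otimes> t (s, h)) (\<phi> (inv (t (s, h))) q)) (\<phi> (a \<otimes> t (s, h)) z) \<le> 2 * \<epsilon>"
            using z(2) i by blast
          moreover have "\<phi> (a \<otimes> t (s, h)) (\<phi> (inv (t (s, h))) q) = \<phi> a q"
            using ac t q by (simp add: composition_rule[symmetric] m_assoc)
          moreover have "d (\<phi> a q) (\<phi> (a \<otimes> t (s, h) \<otimes> inv g) p) \<le>
              d (\<phi> a q) (\<phi> (a \<otimes> t (s, h)) z) + d (\<phi> (a \<otimes> t (s, h)) z) (\<phi> (a \<otimes> t (s, h) \<otimes> inv g) p)"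
            using ac t p q z gc by (intro triangle) auto
          ultimately show ?thesis
            using window[OF hH a] \<epsilon>(2) r commute[of "\<phi> (a \<otimes> t (s, h)) z"] by simp
        qed
        then show "h \<in> forced g s" using hH by (auto simp: forced_def)
      next
        fix h assume h: "h \<in> forced g s"
        then have hH: "h \<in> H" by (auto simp: forced_def)
        note t = tc[OF s(1) hH]
        show "h \<in> \<omega> s"
        proof (rule ccontr)
          assume "h \<notin> \<omega> s"
          then have "(s, h) \<notin> I" by (auto simp: I_def)
          have ac: "a0 \<in> carrier G" using a0 A by auto
          let ?g = "a0 \<otimes> t (s, h)"
          have gB: "?g \<in> B (s, h)" using a0 by (auto simp: B_def r_coset_def)
          have sub: "B i \<subseteq> nbhd K F (B i)" if "i \<in> \<Sigma> \<times> H" for i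
            using K tI[OF that] A by (force simp: nbhd_def B_def r_coset_def)
          have "?g \<notin> B i" if i: "i \<in> I" for i
          proof
            assume "?g \<in> B i"
            then have "?g \<in> nbhd K F (B i) \<inter> nbhd K F (B (s, h))"
              using gB sub[of i] sub[of "(s, h)"] i I s(1) hH by blast
            moreover have "i \<noteq> (s, h)" using i \<open>(s, h) \<notin> I\<close> by blast
            ultimately show False
              using disj i I s(1) hH unfolding disjoint_family_on_def by blast
          qed
          then have "d (\<phi> ?g p) (\<phi> ?g z) \<le> 2 * \<epsilon>" using z(3) ac t by auto
          moreover have "d (\<phi> a0 p) (\<phi> ?g p) < \<theta>"
            using t(2) a0 FA(3) ac t p by (auto simp: U_def composition_rule)
          moreover have "d (\<phi> (?g \<otimes> inv g) p) (\<phi> ?g z) < r / 16" using window[OF hH a0] .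
          moreover have "d (\<phi> a0 q) (\<phi> (?g \<otimes> inv g) p) \<le> r / 4"
            using h a0 by (auto simp: forced_def)
          moreover have "d (\<phi> a0 p) (\<phi> a0 q) \<le> d (\<phi> a0 p) (\<phi> ?g p) + d (\<phi> ?g p) (\<phi> a0 q)"
            "d (\<phi> ?g p) (\<phi> a0 q) \<le> d (\<phi> ?g p) (\<phi> ?g z) + d (\<phi> ?g z) (\<phi> a0 q)"
            "d (\<phi> ?g z) (\<phi> a0 q) \<le> d (\<phi> (?g \<otimes> inv g) p) (\<phi> ?g z) + d (\<phi> (?g \<otimes> inv g) p) (\<phi> a0 q)"
            using ac t p q z gc by (auto intro!: triangle dist_triangle)
          ultimately show False
            using far \<epsilon>(2) \<theta>(3) r commute[of "\<phi> (?g \<otimes> inv g) p" "\<phi> a0 q"] by linarith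
        qed
      qed
      then show False using \<omega>(2)[of s] gD by blast
    qed
  qed (use \<theta>(1) F in auto)
qed

section \<open>Counting orbit pieces and the entropy\<close>

text \<open>Each point is coded by centres in \<open>C\<close> near its orbit along
  \<open>B\<close>. Points sharing a code are \<open>\<delta>\<close>-close along \<open>B\<close>,
  so \<open>rigid\<close> and \<open>leb\<close> put them in one member of the join; there are
  \<open>card C ^ card B\<close> codes.\<close>

lemma min_subcover_card_le:
  assumes B: "finite B" "B \<subseteq> carrier G" and A: "A \<subseteq> carrier G"
    and C: "finite C" "C \<subseteq> M" "M \<subseteq> (\<Union>x\<in>C. mball x (\<delta> / 2))"
    and leb: "\<And>x. x \<in> M \<Longrightarrow> \<exists>V\<in>\<U>. \<forall>y\<in>M. d x y \<le> r \<longrightarrow> y \<in> V"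
    and rigid: "\<And>p q a. p \<in> M \<Longrightarrow> q \<in> M \<Longrightarrow> (\<And>g. g \<in> B \<Longrightarrow> d (\<phi> g p) (\<phi> g q) \<le> \<delta>) \<Longrightarrow>
      a \<in> A \<Longrightarrow> d (\<phi> a p) (\<phi> a q) \<le> r"
  shows "min_subcover_card mtopology (join_cover mtopology \<phi> \<U> A) \<le> card C ^ card B"
proof -
  obtain V where V: "\<And>x. x \<in> M \<Longrightarrow> V x \<in> \<U>" "\<And>x y. x \<in> M \<Longrightarrow> y \<in> M \<Longrightarrow> d x y \<le> r \<Longrightarrow> y \<in> V x"
    using leb by metis
  define cell where "cell \<kappa> = {x \<in> M. \<forall>g\<in>B. d (\<kappa> g) (\<phi> g x) < \<delta> / 2}" for \<kappa>
  define pick where "pick \<kappa> = (SOME x. x \<in> cell \<kappa>)" for \<kappa>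
  have pick: "pick \<kappa> \<in> cell \<kappa>" if "cell \<kappa> \<noteq> {}" for \<kappa>
    using that by (simp add: pick_def some_in_eq)
  define piece where "piece \<kappa> = {y \<in> M. \<forall>g\<in>A. \<phi> g y \<in> V (\<phi> g (pick \<kappa>))}" for \<kappa>
  \<comment> \<open>Only codes that occur are kept, so that \<open>pick\<close> yields a point of
    the cell.\<close>
  define P where "P = {\<kappa> \<in> B \<rightarrow>\<^sub>E C. cell \<kappa> \<noteq> {}}"
  have P: "finite P" "card P \<le> card C ^ card B"
  proof -
    have "finite (B \<rightarrow>\<^sub>E C)" using B C by (intro finite_PiE) auto
    moreover have "card (B \<rightarrow>\<^sub>E C) = card C ^ card B" using B by (simp add: card_PiE)
    moreover have "P \<subseteq> B \<rightarrow>\<^sub>E C" by (auto simp: P_def)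
    ultimately show "finite P" "card P \<le> card C ^ card B"
      using finite_subset card_mono by metis+
  qed
  have "piece ` P \<subseteq> join_cover mtopology \<phi> \<U> A"
  proof (rule image_subsetI)
    fix \<kappa> assume "\<kappa> \<in> P"
    then have "pick \<kappa> \<in> M" using pick by (auto simp: P_def cell_def)
    then show "piece \<kappa> \<in> join_cover mtopology \<phi> \<U> A"
      using V(1) A by (auto simp: join_cover_def piece_def intro!: exI[of _ "\<lambda>g. V (\<phi> g (pick \<kappa>))"])
  qed
  moreover have "\<Union>(piece ` P) = topspace mtopology"
  proof (intro equalityI subsetI)
    fix y assume "y \<in> topspace mtopology"
    then have y: "y \<in> M" by simp
    have "\<exists>x\<in>C. d x (\<phi> g y) < \<delta> / 2" if "g \<in> B" for g
    proof -
      have "\<phi> g y \<in> M" using that B y by auto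
      then show ?thesis using C(3) by fastforce
    qed
    then obtain \<kappa> where \<kappa>: "\<And>g. g \<in> B \<Longrightarrow> \<kappa> g \<in> C \<and> d (\<kappa> g) (\<phi> g y) < \<delta> / 2" by metis
    define \<kappa>' where "\<kappa>' = restrict \<kappa> B"
    have \<kappa>': "\<kappa>' \<in> B \<rightarrow>\<^sub>E C" "y \<in> cell \<kappa>'" using \<kappa> y by (auto simp: \<kappa>'_def cell_def)
    then have inP: "\<kappa>' \<in> P" by (auto simp: P_def)
    then have x: "pick \<kappa>' \<in> cell \<kappa>'" using pick by (auto simp: P_def)
    then have xM: "pick \<kappa>' \<in> M" by (simp add: cell_def)
    have close: "d (\<phi> g (pick \<kappa>')) (\<phi> g y) \<le> \<delta>" if g: "g \<in> B" for g
    proof -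
      have "\<kappa>' g \<in> M" "g \<in> carrier G" using \<kappa>'(1) g B C by auto
      then have "d (\<phi> g (pick \<kappa>')) (\<phi> g y) \<le> d (\<kappa>' g) (\<phi> g (pick \<kappa>')) + d (\<kappa>' g) (\<phi> g y)"
        using xM y by (intro dist_triangle) auto
      moreover have "d (\<kappa>' g) (\<phi> g (pick \<kappa>')) < \<delta> / 2" "d (\<kappa>' g) (\<phi> g y) < \<delta> / 2"
        using x \<kappa>'(2) g by (auto simp: cell_def)
      ultimately show ?thesis by linarith
    qed
    have "\<phi> a y \<in> V (\<phi> a (pick \<kappa>'))" if a: "a \<in> A" for a
      using rigid[OF xM y close a] V(2) a A xM y by auto
    then have "y \<in> piece \<kappa>'" using y by (simp add: piece_def)
    then show "y \<in> \<Union>(piece ` P)" using inP by blast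
  qed (auto simp: piece_def)
  ultimately have "min_subcover_card mtopology (join_cover mtopology \<phi> \<U> A) \<le> card (piece ` P)"
    unfolding min_subcover_card_def using P by (intro Least_le exI[of _ "piece ` P"]) auto
  also have "\<dots> \<le> card P" using P by (intro card_image_le)
  finally show ?thesis using P by linarith
qed

text \<open>Rigidity bounds the cover count exponentially in the size of
  \<open>(F <#> S n) - S n\<close>, a part of the symmetric difference that the Folner condition
  makes negligible against \<open>S n\<close>.\<close>

theorem topological_entropy_eq_0:
  assumes inf: "infinite (carrier G)"
    and min: "minimal_action G mtopology \<phi>"
    and exp: "expansive_action G mtopology d \<phi>"
    and markov: "strong_topological_Markov_property G mtopology d \<phi>"
    and Fol: "left_Folner_sequence G S"
  shows "topological_entropy mtopology \<phi> S = 0"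
proof -
  have "lim (\<lambda>n. ereal (ln (real (min_subcover_card mtopology (join_cover mtopology \<phi> \<U> (S n)))) / real (card (S n)))) = 0"
    if \<U>: "open_cover mtopology \<U>" for \<U>
  proof -
    let ?N = "\<lambda>n. min_subcover_card mtopology (join_cover mtopology \<phi> \<U> (S n))"
    have cM: "compactin mtopology M" using compact by (simp add: compact_space_def)
    obtain e where e: "e > 0" "\<And>x. x \<in> M \<Longrightarrow> \<exists>V\<in>\<U>. mball x e \<subseteq> V"
    proof -
      have "M \<subseteq> \<Union>\<U>" "\<And>V. V \<in> \<U> \<Longrightarrow> openin mtopology V"
        using \<U> unfolding open_cover_def topspace_mtopology by blast+
      from lebesgue_number[OF cM this] show thesis using that by blast
    qed
    have leb: "\<exists>V\<in>\<U>. \<forall>y\<in>M. d x y \<le> e / 2 \<longrightarrow> y \<in> V" if "x \<in> M" for x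
    proof -
      obtain V where V: "V \<in> \<U>" "mball x e \<subseteq> V" using e(2)[OF \<open>x \<in> M\<close>] by blast
      have "y \<in> mball x e" if "y \<in> M" "d x y \<le> e / 2" for y
        using that \<open>x \<in> M\<close> e(1) by simp
      then show ?thesis using V by blast
    qed
    obtain \<delta> F where \<delta>: "0 < \<delta>" and F: "finite F" "F \<subseteq> carrier G" "\<one> \<in> F"
      and rigid: "\<And>A p q a. finite A \<Longrightarrow> A \<subseteq> carrier G \<Longrightarrow> p \<in> M \<Longrightarrow> q \<in> M \<Longrightarrow>
      (\<And>g. g \<in> (F <#> A) - A \<Longrightarrow> d (\<phi> g p) (\<phi> g q) \<le> \<delta>) \<Longrightarrow> a \<in> A \<Longrightarrow> d (\<phi> a p) (\<phi> a q) \<le> e / 2"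
      by (rule boundary_rigidity[OF inf min exp markov, of "e / 2"]) (use e(1) in auto)
    have "mtotally_bounded M" using cM by (rule compactin_imp_mtotally_bounded)
    then obtain C where C: "finite C" "C \<subseteq> M" "M \<subseteq> (\<Union>x\<in>C. mball x (\<delta> / 2))"
      using \<delta> unfolding mtotally_bounded_def by (meson half_gt_zero)
    have S: "finite (S n)" "S n \<subseteq> carrier G" for n using Fol by (auto simp: left_Folner_sequence_def)
    have lim0: "(\<lambda>n. real (card (sym_diff (F <#> S n) (S n))) / real (card (S n))) \<longlonglongrightarrow> 0"
      using Fol F by (auto simp: left_Folner_sequence_def)
    \<comment> \<open>\<open>Suc\<close> keeps \<open>L\<close> nonnegative even if \<open>C\<close>
      is empty.\<close>
    define L where "L = ln (real (Suc (card C)))"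
    have le: "ln (real (?N n)) \<le> real (card (sym_diff (F <#> S n) (S n))) * L" for n
    \<comment> \<open>In an empty space the count is 0, where \<open>ln\<close> takes the default
      value 0.\<close>
    proof (cases "?N n = 0")
      case True
      then show ?thesis by (simp add: L_def)
    next
      case False
      have fin: "finite (F <#> S n)" "F <#> S n \<subseteq> carrier G"
        using F(1) S set_mult_closed[OF F(2) S(2)] by (auto simp: set_mult_def)
      let ?b = "card ((F <#> S n) - S n)"
      have "?N n \<le> card C ^ ?b"
      proof (rule min_subcover_card_le[OF _ _ S(2) C leb])
        show "d (\<phi> a p) (\<phi> a q) \<le> e / 2"
          if "p \<in> M" "q \<in> M" "\<And>g. g \<in> (F <#> S n) - S n \<Longrightarrow> d (\<phi> g p) (\<phi> g q) \<le> \<delta>" "a \<in> S n" for p q a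
          using that by (rule rigid[OF S])
      qed (use fin in auto)
      also have "\<dots> \<le> Suc (card C) ^ ?b" by (intro power_mono) auto
      finally have "real (?N n) \<le> real (Suc (card C)) ^ ?b" by (metis of_nat_le_iff of_nat_power)
      then have "ln (real (?N n)) \<le> ln (real (Suc (card C)) ^ ?b)" using False by (intro ln_mono) auto
      also have "\<dots> = real ?b * L" unfolding L_def by (rule ln_realpow)
      also have "\<dots> \<le> real (card (sym_diff (F <#> S n) (S n))) * L"
        using fin S by (intro mult_right_mono of_nat_mono card_mono) (auto simp: L_def)
      finally show ?thesis .
    qed
    have "(\<lambda>n. ln (real (?N n)) / real (card (S n))) \<longlonglongrightarrow> 0"
    proof (rule tendsto_sandwich)
      show "\<forall>\<^sub>F n in sequentially. 0 \<le> ln (real (?N n)) / real (card (S n))"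
      proof (intro always_eventually allI divide_nonneg_nonneg)
        show "0 \<le> ln (real (?N n))" for n by (cases "?N n") auto
      qed simp
      show "\<forall>\<^sub>F n in sequentially. ln (real (?N n)) / real (card (S n))
          \<le> real (card (sym_diff (F <#> S n) (S n))) / real (card (S n)) * L"
        using le by (intro always_eventually allI) (simp add: divide_right_mono)
      show "(\<lambda>n. real (card (sym_diff (F <#> S n) (S n))) / real (card (S n)) * L) \<longlonglongrightarrow> 0"
        using tendsto_mult_right[OF lim0, of L] by simp
    qed simp
    then have "(\<lambda>n. ereal (ln (real (?N n)) / real (card (S n)))) \<longlonglongrightarrow> ereal 0"
      by (rule tendsto_ereal)
    then show ?thesis by (simp add: limI zero_ereal_def)
  qed
  then have "topological_entropy mtopology \<phi> S = (SUP \<U>\<in>{\<U>. open_cover mtopology \<U>}. 0)"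
    unfolding topological_entropy_def by (intro SUP_cong) auto
  \<comment> \<open>The supremum of an empty family would be \<open>-\<infinity>\<close>, so an open
    cover has to be exhibited.\<close>
  moreover have "open_cover mtopology {topspace mtopology}"
    unfolding open_cover_def using openin_topspace by blast
  ultimately show ?thesis by (metis SUP_const empty_iff mem_Collect_eq)
qed

end

section \<open>Transfer from the metric topology to \<open>X\<close>\<close>

theorem corollary7p13:
  fixes G :: "('g, 'm) monoid_scheme"
    and X :: "'x topology"
    and d :: "'x \<Rightarrow> 'x \<Rightarrow> real"
    and \<phi> :: "'g \<Rightarrow> 'x \<Rightarrow> 'x"
    and F :: "nat \<Rightarrow> 'g set"
  assumes "group G" and "countable (carrier G)" and "infinite (carrier G)" and "amenable G"
    and "compact_space X"
    and "Metric_space (topspace X) d" and "Metric_space.mtopology (topspace X) d = X"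
    and "action_by_homeos G X \<phi>"
    and "minimal_action G X \<phi>"
    and "expansive_action G X d \<phi>"
    and "strong_topological_Markov_property G X d \<phi>"
    and "left_Folner_sequence G F"
  shows "topological_entropy X \<phi> F = 0"
proof -
  interpret group G by fact
  interpret group_action G "topspace X" \<phi>
    using assms(8) by (simp add: action_by_homeos_def)
  interpret Metric_space "topspace X" d by fact
  note X = \<open>mtopology = X\<close>
  interpret compact_metric_action G "topspace X" \<phi> d
  proof
    show "compact_space mtopology" using X assms(5) by simp
    show "continuous_map mtopology mtopology (\<phi> g)" if "g \<in> carrier G" for g
      using assms(8) that homeomorphic_imp_continuous_map by (auto simp: X action_by_homeos_def)
  qed
  show ?thesis
    using topological_entropy_eq_0 assms unfolding X by blast
qed

end
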